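(* Let $n\ge 2$. The folding map $\mathcal{F}$ restricts to a bijection from the set $\mathbf{WT}(\mathfrak{CS}_{2n})=\{\mathbf{WT}(\pi):\pi\in\mathfrak{CS}_{2n}\}$ of centrally symmetric Waldspurger matrices of type $A_{2n-1}$ onto the set $\mathbf{WT}_{C_n}(B_n)=\{\mathbf{WT}_{C_n}(g):g\in B_n\}$ of Waldspurger matrices of type $C_n$, and the corresponding square commutes: for every $\pi\in\mathfrak{CS}_{2n}$, $$\mathcal{F}(\mathbf{WT}(\pi))=\mathbf{WT}_{C_n}(\pi^\star).$$
   Context: $\mathfrak{CS}_{2n}$ denotes the set of $2n\times2n$ permutation matrices $\pi$ that are centrally symmetric, i.e. invariant under $180^\circ$ rotation: $\pi_{i,j}=\pi_{2n+1-i,2n+1-j}$. $B_n$ denotes the group of $n\times n$ signed permutation matrices. For $\pi\in\mathfrak{CS}_{2n}$ define $\pi^\star\in B_n$ by $\pi^\star_{i,j}=\pi_{i,j}-\pi_{2n-i+1,j}$, $1\le i,j\le n$. For an $N\times N$ permutation matrix $\pi$, $\mathbf{WT}(\pi)$ (the type $A_{N-1}$ Waldspurger matrix) is the $(N-1)\times(N-1)$ matrix with $$\mathbf{WT}(\pi)_{i,j}=\begin{cases}\sum_{a\le i,\ b>j}\pi_{a,b} & i\le j,\\ \sum_{a>i,\ b\le j}\pi_{a,b} & i\ge j\end{cases}$$ (the formulas agree for $i=j$). For the root system of type $C_n$ in $\mathbb{R}^n$ take simple roots $\alpha_i=e_i-e_{i+1}$ ($1\le i\le n-1$) and $\alpha_n=2e_n$.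 For $g\in B_n$ acting on column vectors in $\mathbb{R}^n$, $\mathbf{WT}_{C_n}(g)=(\mathrm{Id}-R_g)C_{C_n}^{-1}$, where $R_g$ is the matrix of $g$ in the basis of simple roots and $C_{C_n}$ is the Cartan matrix whose inverse has as its columns the fundamental weights in simple root coordinates: $(C_{C_n}^{-1})_{i,j}=\min(i,j)$ if $i<n$ and $(C_{C_n}^{-1})_{n,j}=j/2$. Equivalently, column $j$ of $\mathbf{WT}_{C_n}(g)$ is the vector of simple root coordinates of $\omega_j-g\omega_j$, where $\omega_j=e_1+\dots+e_j$. The folding map $\mathcal{F}$ sends a $(2n-1)\times(2n-1)$ matrix $M$ to the $n\times n$ matrix $$\mathcal{F}(M)_{i,j}=\begin{cases}M_{i,j}+M_{2n-i,j} & 1\le i<n,\ 1\le j\le n,\\ M_{n,j} & i=n,\ 1\le j\le n.\end{cases}$$ *)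

theory Defs
  imports Complex_Main "Jordan_Normal_Form.Determinant"
begin

(* All matrices are real and, as usual for this matrix type, indexed from 0.  A 1-based index i thus
   becomes i - 1; the rotation i \<mapsto> 2n + 1 - i becomes i \<mapsto> 2n - 1 - i, and i \<mapsto> 2n - i becomes
   i \<mapsto> 2n - 2 - i. *)

definition permutation_matrices :: "nat \<Rightarrow> real mat set" where
  "permutation_matrices N = {P \<in> carrier_mat N N.
     (\<forall>i<N. \<forall>j<N. P $$ (i, j) \<in> {0, 1}) \<and>
     (\<forall>i<N. \<exists>!j. j < N \<and> P $$ (i, j) = 1) \<and>
     (\<forall>j<N. \<exists>!i. i < N \<and> P $$ (i, j) = 1)}"

definition signed_permutation_matrices :: "nat \<Rightarrow> real mat set" where
  "signed_permutation_matrices n = {g \<in> carrier_mat n n.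
     (\<forall>i<n. \<forall>j<n. g $$ (i, j) \<in> {-1, 0, 1}) \<and>
     (\<forall>i<n. \<exists>!j. j < n \<and> g $$ (i, j) \<noteq> 0) \<and>
     (\<forall>j<n. \<exists>!i. i < n \<and> g $$ (i, j) \<noteq> 0)}"

(* The parameter n is half the size of the matrices. *)
definition centrally_symmetric_perms :: "nat \<Rightarrow> real mat set" where
  "centrally_symmetric_perms n = {P \<in> permutation_matrices (2 * n).
     \<forall>i<2 * n. \<forall>j<2 * n. P $$ (i, j) = P $$ (2 * n - 1 - i, 2 * n - 1 - j)}"

definition star :: "nat \<Rightarrow> real mat \<Rightarrow> real mat" where
  "star n P = mat n n (\<lambda>(i, j). P $$ (i, j) - P $$ (2 * n - 1 - i, j))"

definition waldspurger_A :: "real mat \<Rightarrow> real mat" where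
  "waldspurger_A P = (let N = dim_row P in
     mat (N - 1) (N - 1) (\<lambda>(i, j).
       if i \<le> j then (\<Sum>a\<in>{..i}. \<Sum>b\<in>{j<..<N}. P $$ (a, b))
       else (\<Sum>a\<in>{i<..<N}. \<Sum>b\<in>{..j}. P $$ (a, b))))"

definition simple_root_C :: "nat \<Rightarrow> nat \<Rightarrow> real vec" where
  "simple_root_C n j =
     (if j < n - 1 then unit_vec n j - unit_vec n (j + 1) else 2 \<cdot>\<^sub>v unit_vec n j)"

definition simple_root_mat_C :: "nat \<Rightarrow> real mat" where
  "simple_root_mat_C n = mat_of_cols n (map (simple_root_C n) [0..<n])"

(* The matrix of g in the basis of simple roots: column j of the equation below says
   that g \<alpha>_j is the sum over k of R_kj \<alpha>_k.  Existence and uniqueness are proved below. *)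
definition simple_root_repr_C :: "nat \<Rightarrow> real mat \<Rightarrow> real mat" where
  "simple_root_repr_C n g =
     (THE R. R \<in> carrier_mat n n \<and> simple_root_mat_C n * R = g * simple_root_mat_C n)"

(* Convention: the (i, j) entry is the pairing of the root \<alpha>_j with the coroot of \<alpha>_i. *)
definition cartan_C :: "nat \<Rightarrow> real mat" where
  "cartan_C n = mat n n (\<lambda>(i, j).
     2 * (simple_root_C n i \<bullet> simple_root_C n j) / (simple_root_C n i \<bullet> simple_root_C n i))"

definition cartan_inv_C :: "nat \<Rightarrow> real mat" where
  "cartan_inv_C n = mat n n (\<lambda>(i, j).
     if i < n - 1 then real (min (i + 1) (j + 1)) else real (j + 1) / 2)"

definition waldspurger_C :: "nat \<Rightarrow> real mat \<Rightarrow> real mat" where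
  "waldspurger_C n g = (1\<^sub>m n - simple_root_repr_C n g) * cartan_inv_C n"

definition folding_map :: "nat \<Rightarrow> real mat \<Rightarrow> real mat" where
  "folding_map n M = mat n n (\<lambda>(i, j).
     if i < n - 1 then M $$ (i, j) + M $$ (2 * n - 2 - i, j) else M $$ (i, j))"


lemma star_signed_permutation:
  assumes P: "P \<in> centrally_symmetric_perms n"
  shows "star n P \<in> signed_permutation_matrices n"
proof -
  have perm: "P \<in> permutation_matrices (2 * n)"
    and symm: "\<forall>i<2 * n. \<forall>j<2 * n. P $$ (i, j) = P $$ (2 * n - 1 - i, 2 * n - 1 - j)"
    using P unfolding centrally_symmetric_perms_def by blast+
  have zo: "P $$ (i, j) = 0 \<or> P $$ (i, j) = 1" if "i < 2 * n" "j < 2 * n" for i j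
    using perm that unfolding permutation_matrices_def by blast
  have row: "\<exists>!j. j < 2 * n \<and> P $$ (i, j) = 1" if "i < 2 * n" for i
    using perm that unfolding permutation_matrices_def mem_Collect_eq by (elim conjE allE impE)
  have col: "\<exists>!i. i < 2 * n \<and> P $$ (i, j) = 1" if "j < 2 * n" for j
    using perm that unfolding permutation_matrices_def mem_Collect_eq by (elim conjE allE impE)
  have sym: "P $$ (2 * n - 1 - i, 2 * n - 1 - j) = P $$ (i, j)" if "i < 2 * n" "j < 2 * n" for i j
    using symm[rule_format, OF that] by (rule HOL.sym)
  have excl: "\<not> (P $$ (i, j) = 1 \<and> P $$ (2 * n - 1 - i, j) = 1)" if "i < n" "j < n" for i j
  proof
    assume "P $$ (i, j) = 1 \<and> P $$ (2 * n - 1 - i, j) = 1"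
    moreover have "i < 2 * n" "2 * n - 1 - i < 2 * n" "j < 2 * n" using that by auto
    ultimately have "i = 2 * n - 1 - i" using col[of j] by blast
    then show False using that by linarith
  qed
  have nz: "star n P $$ (i, j) \<noteq> 0 \<longleftrightarrow> P $$ (i, j) = 1 \<or> P $$ (2 * n - 1 - i, j) = 1"
    if "i < n" "j < n" for i j
    using that excl[OF that] zo[of i j] zo[of "2 * n - 1 - i" j] by (auto simp: star_def)
  show ?thesis
    unfolding signed_permutation_matrices_def
  proof (intro CollectI conjI allI impI)
    show "star n P \<in> carrier_mat n n" by (simp add: star_def)
  next
    fix i j assume "i < n" "j < n"
    then show "star n P $$ (i, j) \<in> {-1, 0, 1}"
      using zo[of i j] zo[of "2 * n - 1 - i" j] by (auto simp: star_def)
  next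
    fix i assume i: "i < n"
    have flip: "P $$ (i, 2 * n - 1 - j) = P $$ (2 * n - 1 - i, j)" if "j < 2 * n" for j
      using sym[of "2 * n - 1 - i" j] i that by simp
    obtain k where k: "k < 2 * n" "P $$ (i, k) = 1"
      and uniq: "\<And>l. l < 2 * n \<Longrightarrow> P $$ (i, l) = 1 \<Longrightarrow> l = k"
      using row[of i] i by auto
    have only: "j = (if k < n then k else 2 * n - 1 - k)"
      if j: "j < n" and "P $$ (i, j) = 1 \<or> P $$ (2 * n - 1 - i, j) = 1" for j
      using that(2)
    proof
      assume "P $$ (i, j) = 1"
      then have "j = k" by (intro uniq) (use j in linarith)
      then show ?thesis using j by simp
    next
      assume "P $$ (2 * n - 1 - i, j) = 1"
      moreover have "j < 2 * n" using j by linarith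
      ultimately have "P $$ (i, 2 * n - 1 - j) = 1" using flip by (simp only:)
      then have "2 * n - 1 - j = k" by (intro uniq) (use j in linarith)
      then have "\<not> k < n" "j = 2 * n - 1 - k" using j by linarith+
      then show ?thesis by simp
    qed
    show "\<exists>!j. j < n \<and> star n P $$ (i, j) \<noteq> 0"
    proof (rule ex1I[of _ "if k < n then k else 2 * n - 1 - k"])
      show "(if k < n then k else 2 * n - 1 - k) < n \<and>
          star n P $$ (i, if k < n then k else 2 * n - 1 - k) \<noteq> 0"
      proof (cases "k < n")
        case True
        have "star n P $$ (i, k) \<noteq> 0" using nz[OF i True] k(2) by blast
        then show ?thesis by (simp only: True if_True simp_thms)
      next
        case False
        then have lt: "2 * n - 1 - k < n" "2 * n - 1 - k < 2 * n" using k(1) by linarith+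
        have "2 * n - 1 - (2 * n - 1 - k) = k" using k(1) by linarith
        then have "P $$ (2 * n - 1 - i, 2 * n - 1 - k) = 1" using flip[OF lt(2)] k(2) by (simp only:)
        then have "star n P $$ (i, 2 * n - 1 - k) \<noteq> 0" using nz[OF i lt(1)] by blast
        then show ?thesis by (simp only: False lt(1) if_False simp_thms)
      qed
    next
      fix l assume "l < n \<and> star n P $$ (i, l) \<noteq> 0"
      then show "l = (if k < n then k else 2 * n - 1 - k)" by (intro only) (use nz[OF i, of l] in blast)+
    qed
  next
    fix j assume j: "j < n"
    obtain k where k: "k < 2 * n" "P $$ (k, j) = 1"
      and uniq: "\<And>l. l < 2 * n \<Longrightarrow> P $$ (l, j) = 1 \<Longrightarrow> l = k"
      using col[of j] j by auto
    have only: "i = (if k < n then k else 2 * n - 1 - k)"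
      if i: "i < n" and "P $$ (i, j) = 1 \<or> P $$ (2 * n - 1 - i, j) = 1" for i
      using that(2)
    proof
      assume "P $$ (i, j) = 1"
      then have "i = k" by (intro uniq) (use i in linarith)
      then show ?thesis using i by simp
    next
      assume "P $$ (2 * n - 1 - i, j) = 1"
      then have "2 * n - 1 - i = k" by (intro uniq) (use i in linarith)
      then have "\<not> k < n" "i = 2 * n - 1 - k" using i by linarith+
      then show ?thesis by simp
    qed
    show "\<exists>!i. i < n \<and> star n P $$ (i, j) \<noteq> 0"
    proof (rule ex1I[of _ "if k < n then k else 2 * n - 1 - k"])
      show "(if k < n then k else 2 * n - 1 - k) < n \<and>
          star n P $$ (if k < n then k else 2 * n - 1 - k, j) \<noteq> 0"
      proof (cases "k < n")
        case True
        have "star n P $$ (k, j) \<noteq> 0" using nz[OF True j] k(2) by blast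
        then show ?thesis by (simp only: True if_True simp_thms)
      next
        case False
        then have lt: "2 * n - 1 - k < n" using k(1) by linarith
        have "2 * n - 1 - (2 * n - 1 - k) = k" using k(1) by linarith
        then have "P $$ (2 * n - 1 - (2 * n - 1 - k), j) = 1" using k(2) by (simp only:)
        then have "star n P $$ (2 * n - 1 - k, j) \<noteq> 0" using nz[OF lt j] by blast
        then show ?thesis by (simp only: False lt if_False simp_thms)
      qed
    next
      fix l assume "l < n \<and> star n P $$ (l, j) \<noteq> 0"
      then show "l = (if k < n then k else 2 * n - 1 - k)" by (intro only) (use nz[OF _ j, of l] in blast)+
    qed
  qed
qed

lemma simple_root_mat_C_carrier [simp]: "simple_root_mat_C n \<in> carrier_mat n n"
  unfolding simple_root_mat_C_def using mat_of_cols_carrier(1)[of n "map (simple_root_C n) [0..<n]"]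
  by simp

lemma simple_root_C_index:
  assumes "i < n" "j < n"
  shows "simple_root_C n j $ i = (if i = j then (if j = n - 1 then 2 else 1)
                                  else if i = j + 1 then -1 else 0)"
  using assms by (auto simp: simple_root_C_def)

lemma simple_root_mat_C_index:
  assumes "i < n" "j < n"
  shows "simple_root_mat_C n $$ (i, j) = (if i = j then (if j = n - 1 then 2 else 1)
                                          else if i = j + 1 then -1 else 0)"
  using assms by (simp add: simple_root_mat_C_def mat_of_cols_index simple_root_C_index)

lemma simple_root_mat_C_mult_index:
  assumes M: "M \<in> carrier_mat n m" and i: "i < n" and j: "j < m"
  shows "(simple_root_mat_C n * M) $$ (i, j) =
     (if i = n - 1 then 2 else 1) * M $$ (i, j) - (if i = 0 then 0 else M $$ (i - 1, j))"
proof -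
  have "(simple_root_mat_C n * M) $$ (i, j) =
      (\<Sum>k\<in>{0..<n}. simple_root_mat_C n $$ (i, k) * M $$ (k, j))"
    using assms carrier_matD[OF simple_root_mat_C_carrier[of n]] by (simp add: scalar_prod_def)
  also have "\<dots> = (\<Sum>k\<in>{0..<n}. (if k = i then (if i = n - 1 then 2 else 1) * M $$ (i, j) else 0)
      - (if k = i - 1 then (if i = 0 then 0 else M $$ (i - 1, j)) else 0))"
    using i by (intro sum.cong refl) (auto simp: simple_root_mat_C_index)
  also have "\<dots> = (if i = n - 1 then 2 else 1) * M $$ (i, j) - (if i = 0 then 0 else M $$ (i - 1, j))"
    using i by (simp add: sum_subtractf)
  finally show ?thesis .
qed

lemma simple_root_mat_C_inverse:
  obtains T where "T \<in> carrier_mat n n" "simple_root_mat_C n * T = 1\<^sub>m n"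
    "T * simple_root_mat_C n = 1\<^sub>m n"
proof -
  define T :: "real mat" where
    "T = mat n n (\<lambda>(i, j). if j \<le> i then (if i = n - 1 then 1 / 2 else 1) else 0)"
  have T: "T \<in> carrier_mat n n" by (simp add: T_def)
  have 1: "simple_root_mat_C n * T = 1\<^sub>m n"
  proof (rule eq_matI)
    fix i j assume "i < dim_row (1\<^sub>m n :: real mat)" "j < dim_col (1\<^sub>m n :: real mat)"
    then have "i < n" "j < n" by auto
    then show "(simple_root_mat_C n * T) $$ (i, j) = 1\<^sub>m n $$ (i, j)"
      unfolding simple_root_mat_C_mult_index[OF T \<open>i < n\<close> \<open>j < n\<close>] by (auto simp: T_def)
  qed (use T carrier_matD[OF simple_root_mat_C_carrier[of n]] in auto)
  show thesis
    using that[OF T 1 mat_mult_left_right_inverse[OF simple_root_mat_C_carrier T 1]] .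
qed

lemma simple_root_repr_C_ex1:
  assumes g: "g \<in> carrier_mat n n"
  shows "\<exists>!R. R \<in> carrier_mat n n \<and> simple_root_mat_C n * R = g * simple_root_mat_C n"
proof -
  obtain T where T: "T \<in> carrier_mat n n" "simple_root_mat_C n * T = 1\<^sub>m n"
    "T * simple_root_mat_C n = 1\<^sub>m n" by (rule simple_root_mat_C_inverse)
  let ?S = "simple_root_mat_C n"
  have S: "?S \<in> carrier_mat n n" by simp
  show ?thesis
  proof (rule ex1I[of _ "T * (g * ?S)"])
    have "?S * (T * (g * ?S)) = (?S * T) * (g * ?S)"
      by (rule assoc_mult_mat[symmetric, OF S T(1) mult_carrier_mat[OF g S]])
    also have "\<dots> = g * ?S"
      using left_mult_one_mat[OF mult_carrier_mat[OF g S]] by (simp add: T(2))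
    finally show "T * (g * ?S) \<in> carrier_mat n n \<and> ?S * (T * (g * ?S)) = g * ?S"
      using T(1) g S by auto
  next
    fix R assume R: "R \<in> carrier_mat n n \<and> ?S * R = g * ?S"
    have "T * (g * ?S) = T * (?S * R)" using R by simp
    also have "\<dots> = (T * ?S) * R" using assoc_mult_mat[OF T(1) S, of R n] R by simp
    also have "\<dots> = R" using left_mult_one_mat[of R n n] R by (simp add: T(3))
    finally show "R = T * (g * ?S)" by simp
  qed
qed

(* The columns of cartan_inv_C are the simple root coordinates of the fundamental weights
   \<omega>_j = e_1 + ... + e_j. *)
lemma cartan_inv_C_weights:
  "simple_root_mat_C n * cartan_inv_C n = mat n n (\<lambda>(i, j). if i \<le> j then 1 else 0)"
proof (rule eq_matI)
  have C: "cartan_inv_C n \<in> carrier_mat n n" by (simp add: cartan_inv_C_def)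
  fix i j assume "i < dim_row (mat n n (\<lambda>(i, j). if i \<le> j then 1 else 0 :: real))"
    "j < dim_col (mat n n (\<lambda>(i, j). if i \<le> j then 1 else 0 :: real))"
  then have ij: "i < n" "j < n" by auto
  have 1: "(if i = n - 1 then 2 else 1) * cartan_inv_C n $$ (i, j) = real (min (i + 1) (j + 1))"
  proof (cases "i = n - 1")
    case True
    then have "min (i + 1) (j + 1) = j + 1" using ij by linarith
    then show ?thesis using True ij by (simp add: cartan_inv_C_def)
  next
    case False
    then have "i < n - 1" using ij by linarith
    then show ?thesis using False ij by (simp add: cartan_inv_C_def)
  qed
  have 2: "(if i = 0 then 0 else cartan_inv_C n $$ (i - 1, j)) = real (min i (j + 1))"
  proof (cases i)
    case 0
    then show ?thesis by simp
  next
    case (Suc m)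
    then have "m < n - 1" "m < n" using ij by linarith+
    then show ?thesis using Suc ij by (simp add: cartan_inv_C_def)
  qed
  have "(simple_root_mat_C n * cartan_inv_C n) $$ (i, j) =
      real (min (i + 1) (j + 1)) - real (min i (j + 1))"
    unfolding simple_root_mat_C_mult_index[OF C ij] 1 2 ..
  also have "\<dots> = (if i \<le> j then 1 else 0)"
  proof (cases "i \<le> j")
    case True
    then have "min (i + 1) (j + 1) = i + 1" "min i (j + 1) = i" by linarith+
    then show ?thesis using True by simp
  next
    case False
    then have "min (i + 1) (j + 1) = j + 1" "min i (j + 1) = j + 1" by linarith+
    then show ?thesis using False by simp
  qed
  finally show "(simple_root_mat_C n * cartan_inv_C n) $$ (i, j) =
      mat n n (\<lambda>(i, j). if i \<le> j then 1 else 0) $$ (i, j)" using ij by simp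
next
  show "dim_row (simple_root_mat_C n * cartan_inv_C n) =
      dim_row (mat n n (\<lambda>(i, j). if i \<le> j then 1 else 0 :: real))"
    using carrier_matD[OF simple_root_mat_C_carrier[of n]] by simp
next
  show "dim_col (simple_root_mat_C n * cartan_inv_C n) =
      dim_col (mat n n (\<lambda>(i, j). if i \<le> j then 1 else 0 :: real))"
    by (simp add: cartan_inv_C_def)
qed

lemma cartan_C_inverse: "cartan_C n * cartan_inv_C n = 1\<^sub>m n"
proof -
  define D :: "real mat" where "D = mat n n (\<lambda>(i, k).
    if i = k then 1 else if k = i + 1 then -1 else 0)"
  have D: "D \<in> carrier_mat n n" by (simp add: D_def)
  have C: "cartan_inv_C n \<in> carrier_mat n n" by (simp add: cartan_inv_C_def)
  have norm: "simple_root_C n i \<bullet> simple_root_C n k =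
    (if i = n - 1 then 2 else 1) * simple_root_C n k $ i -
    (if i < n - 1 then simple_root_C n k $ (i + 1) else 0)" if "i < n" "k < n" for i k
  proof -
    have "dim_vec (simple_root_C n k) = n" by (simp add: simple_root_C_def)
    then have "simple_root_C n i \<bullet> simple_root_C n k =
      (\<Sum>l\<in>{0..<n}. simple_root_C n i $ l * simple_root_C n k $ l)"
      by (simp add: scalar_prod_def)
    also have "\<dots> = (\<Sum>l\<in>{0..<n}.
        (if l = i then (if i = n - 1 then 2 else 1) * simple_root_C n k $ i else 0)
      - (if l = i + 1 then simple_root_C n k $ (i + 1) else 0))"
      using that by (intro sum.cong refl) (auto simp: simple_root_C_index)
    also have "\<dots> = (if i = n - 1 then 2 else 1) * simple_root_C n k $ i -
      (if i < n - 1 then simple_root_C n k $ (i + 1) else 0)"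
      using that by (auto simp: sum_subtractf)
    finally show ?thesis .
  qed
  have Dmult: "(D * M) $$ (i, j) = M $$ (i, j) - (if i < n - 1 then M $$ (i + 1, j) else 0)"
    if M: "M \<in> carrier_mat n n" and i: "i < n" and j: "j < n" for M i j
  proof -
    have "(D * M) $$ (i, j) = (\<Sum>k\<in>{0..<n}. D $$ (i, k) * M $$ (k, j))"
      using that carrier_matD[OF D] by (simp add: scalar_prod_def)
    also have "\<dots> = (\<Sum>k\<in>{0..<n}. (if k = i then M $$ (i, j) else 0)
       - (if k = i + 1 then M $$ (i + 1, j) else 0))"
      using i by (intro sum.cong refl) (auto simp: D_def)
    also have "\<dots> = M $$ (i, j) - (if i < n - 1 then M $$ (i + 1, j) else 0)"
      using i by (auto simp: sum_subtractf)
    finally show ?thesis .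
  qed
  have "cartan_C n = D * simple_root_mat_C n"
  proof (rule eq_matI)
    fix i j assume "i < dim_row (D * simple_root_mat_C n)" "j < dim_col (D * simple_root_mat_C n)"
    then have ij: "i < n" "j < n"
      using D carrier_matD[OF simple_root_mat_C_carrier[of n]] by auto
    show "cartan_C n $$ (i, j) = (D * simple_root_mat_C n) $$ (i, j)"
      unfolding Dmult[OF simple_root_mat_C_carrier ij]
      using ij by (auto simp: cartan_C_def norm simple_root_C_index simple_root_mat_C_index)
  qed (use D carrier_matD[OF simple_root_mat_C_carrier[of n]] in \<open>auto simp: cartan_C_def\<close>)
  then have "cartan_C n * cartan_inv_C n = D * (simple_root_mat_C n * cartan_inv_C n)"
    using assoc_mult_mat[OF D simple_root_mat_C_carrier C] by simp
  also have "\<dots> = 1\<^sub>m n"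
  proof (rule eq_matI)
    fix i j assume "i < dim_row (1\<^sub>m n :: real mat)" "j < dim_col (1\<^sub>m n :: real mat)"
    then have ij: "i < n" "j < n" by auto
    show "(D * (simple_root_mat_C n * cartan_inv_C n)) $$ (i, j) = 1\<^sub>m n $$ (i, j)"
      unfolding Dmult[OF mult_carrier_mat[OF simple_root_mat_C_carrier C] ij]
      unfolding cartan_inv_C_weights using ij by auto
  qed (use D C in auto)
  finally show ?thesis .
qed

end

theory Submission
  imports Defs
begin

text \<open>
  Both kinds of Waldspurger matrix are tables of upper left corner sums. Since a permutation matrix
  \<open>P\<close> has the same row and column sums as the identity, the two cases in the definition of type \<open>A\<close>
  merge: entry \<open>(i, j)\<close> is the corner sum of \<open>1 - P\<close> over rows up to \<open>i\<close> and columns up to \<open>j\<close>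
  (\<open>waldspurger_A_corner_sum\<close>). In type \<open>C\<close>, writing \<open>S\<close> for the matrix of simple roots and
  \<open>\<Omega>\<close> for the matrix of fundamental weights, the defining equations give
  \<open>S * WT(g) = (1 - g) * \<Omega>\<close>. Multiplying by \<open>\<Omega>\<close> takes partial sums along rows, and inverting \<open>S\<close>
  takes partial sums down columns, halving the last row; so \<open>WT(g)\<close> is the table of corner sums of
  \<open>1 - g\<close> with its last row halved (\<open>waldspurger_C_eqI\<close>).

  Folding adds rows \<open>i\<close> and \<open>2 * n - 2 - i\<close>, except that the middle row is left alone, which is the
  same as adding it to itself and halving. The columns of \<open>1 - P\<close> sum to zero, so the corner sum that
  ends in row \<open>2 * n - 2 - i\<close> is minus the sum over the last \<open>i + 1\<close> rows. Adding the two corner sums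
  therefore subtracts from each row \<open>a\<close> its mirror image \<open>2 * n - 1 - a\<close>, which is what \<open>star\<close> does:
  the result is the corner sum of \<open>star (1 - P) = 1 - star P\<close>, and the square commutes.

  Bijectivity follows from the square: \<open>star\<close> is a bijection from centrally symmetric
  permutations to signed permutations (\<open>bij_betw_star\<close>) and \<open>waldspurger_C\<close> is injective, since
  \<open>\<Omega>\<close> is invertible (\<open>inj_on_waldspurger_C\<close>). If two folded matrices agree, then so do their
  images under \<open>star\<close>, hence the permutations themselves.
\<close>

section \<open>Waldspurger matrices of type A as corner sums\<close>

definition corner_sum :: "real mat \<Rightarrow> nat \<Rightarrow> nat \<Rightarrow> real" where
  "corner_sum X i j = (\<Sum>a\<le>i. \<Sum>b\<le>j. X $$ (a, b))"

lemma sum_indicator_eq_1: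
  fixes f :: "nat \<Rightarrow> real"
  assumes "\<And>j. j < N \<Longrightarrow> f j \<in> {0, 1}" and "\<exists>!j. j < N \<and> f j = 1"
  shows "(\<Sum>j<N. f j) = 1"
proof -
  from assms(2) obtain k where k: "k < N \<and> f k = 1"
    and uniq: "\<forall>j. j < N \<and> f j = 1 \<longrightarrow> j = k"
    by (rule ex1E)
  have "f j = (if j = k then 1 else 0)" if "j < N" for j
  proof (cases "j = k")
    case False
    then have "f j \<noteq> 1" using uniq that by blast
    then show ?thesis using assms(1)[OF that] False by simp
  qed (simp add: k)
  then have "(\<Sum>j<N. f j) = (\<Sum>j<N. if j = k then 1 else 0)" by simp
  then show ?thesis using k by simp
qed

lemma permutation_matricesD:
  assumes "P \<in> permutation_matrices N"
  shows "P \<in> carrier_mat N N"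
    and "\<And>i j. i < N \<Longrightarrow> j < N \<Longrightarrow> P $$ (i, j) \<in> {0, 1}"
    and "\<And>i. i < N \<Longrightarrow> \<exists>!j. j < N \<and> P $$ (i, j) = 1"
    and "\<And>j. j < N \<Longrightarrow> \<exists>!i. i < N \<and> P $$ (i, j) = 1"
proof -
  note D = assms[unfolded permutation_matrices_def mem_Collect_eq]
  show "P \<in> carrier_mat N N" using D by (rule conjunct1)
  note D = D[THEN conjunct2]
  show "P $$ (i, j) \<in> {0, 1}" if "i < N" "j < N" for i j
    using D[THEN conjunct1] that by (elim allE impE)
  note D = D[THEN conjunct2]
  show "\<exists>!j. j < N \<and> P $$ (i, j) = 1" if "i < N" for i
    using D[THEN conjunct1] that by (elim allE impE)
  show "\<exists>!i. i < N \<and> P $$ (i, j) = 1" if "j < N" for j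
    using D[THEN conjunct2] that by (elim allE impE)
qed

lemma permutation_matrix_row_sum:
  assumes "P \<in> permutation_matrices N" and "i < N"
  shows "(\<Sum>j<N. P $$ (i, j)) = 1"
  using assms by (intro sum_indicator_eq_1 permutation_matricesD)

lemma permutation_matrix_col_sum:
  assumes "P \<in> permutation_matrices N" and "j < N"
  shows "(\<Sum>i<N. P $$ (i, j)) = 1"
  using assms by (intro sum_indicator_eq_1 permutation_matricesD)

lemma sum_lessThan_split:
  fixes f :: "nat \<Rightarrow> real"
  assumes "i < N"
  shows "(\<Sum>a<N. f a) = (\<Sum>a\<le>i. f a) + (\<Sum>a\<in>{i<..<N}. f a)"
proof -
  have "{..<N} = {..i} \<union> {i<..<N}" using assms by auto
  moreover have "sum f ({..i} \<union> {i<..<N}) = (\<Sum>a\<le>i. f a) + (\<Sum>a\<in>{i<..<N}. f a)"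
    by (intro sum.union_disjoint) auto
  ultimately show ?thesis by metis
qed

text \<open>The first case of the definition completes the first \<open>i + 1\<close> row sums, the second one the first
  \<open>j + 1\<close> column sums. Since the sums are all 1, either way the entry is \<open>min i j + 1\<close> minus the corner
  sum of \<open>P\<close>, and \<open>min i j + 1\<close> is the corner sum of the identity.\<close>

lemma waldspurger_A_corner_sum:
  assumes P: "P \<in> permutation_matrices N" and i: "i < N - 1" and j: "j < N - 1"
  shows "waldspurger_A P $$ (i, j) = corner_sum (1\<^sub>m N - P) i j"
proof -
  have dim: "dim_row P = N" "dim_col P = N" using permutation_matricesD(1)[OF P] by auto
  have diff: "corner_sum (1\<^sub>m N - P) i j
      = (\<Sum>a\<le>i. \<Sum>b\<le>j. (if a = b then 1 else 0) - P $$ (a, b))"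
    unfolding corner_sum_def using i j dim by (intro sum.cong refl) auto
  show ?thesis
  proof (cases "i \<le> j")
    case True
    have "(\<Sum>b\<in>{j<..<N}. P $$ (a, b)) = (\<Sum>b\<le>j. (if a = b then 1 else 0) - P $$ (a, b))"
      if "a \<le> i" for a
    proof -
      have "a < N" "j < N" "a \<le> j" using that i j True by linarith+
      then show ?thesis
        using permutation_matrix_row_sum[OF P, of a]
          sum_lessThan_split[of j N "\<lambda>b. P $$ (a, b)"]
        by (simp add: sum_subtractf)
    qed
    then show ?thesis
      using True i j dim unfolding diff waldspurger_A_def by (simp add: Let_def)
  next
    case False
    have "(\<Sum>a\<in>{i<..<N}. P $$ (a, b)) = (\<Sum>a\<le>i. (if a = b then 1 else 0) - P $$ (a, b))"
      if "b \<le> j" for b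
    proof -
      have "b < N" "i < N" "b \<le> i" using that i j False by linarith+
      then show ?thesis
        using permutation_matrix_col_sum[OF P, of b]
          sum_lessThan_split[of i N "\<lambda>a. P $$ (a, b)"]
        by (simp add: sum_subtractf)
    qed
    then have "(\<Sum>b\<le>j. \<Sum>a\<in>{i<..<N}. P $$ (a, b))
        = (\<Sum>b\<le>j. \<Sum>a\<le>i. (if a = b then 1 else 0) - P $$ (a, b))"
      by simp
    moreover have "waldspurger_A P $$ (i, j) = (\<Sum>b\<le>j. \<Sum>a\<in>{i<..<N}. P $$ (a, b))"
      using False i j dim unfolding waldspurger_A_def
      by (simp add: Let_def sum.swap[of _ "{..j}"])
    ultimately show ?thesis
      unfolding diff by (simp add: sum.swap[of _ "{..j}"])
  qed
qed

section \<open>Waldspurger matrices of type C as corner sums\<close>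

abbreviation weight_mat :: "nat \<Rightarrow> real mat" where
  "weight_mat n \<equiv> mat n n (\<lambda>(i, j). if i \<le> j then 1 else 0)"

lemma simple_root_repr_C:
  assumes "g \<in> carrier_mat n n"
  shows "simple_root_repr_C n g \<in> carrier_mat n n"
    and "simple_root_mat_C n * simple_root_repr_C n g = g * simple_root_mat_C n"
  using theI'[OF simple_root_repr_C_ex1[OF assms]] unfolding simple_root_repr_C_def by blast+

lemma waldspurger_C_carrier:
  assumes "g \<in> carrier_mat n n"
  shows "waldspurger_C n g \<in> carrier_mat n n"
  unfolding waldspurger_C_def
  by (rule mult_carrier_mat[OF minus_carrier_mat[OF simple_root_repr_C(1)[OF assms]]])
    (simp add: cartan_inv_C_def)

lemma simple_root_mat_C_mult_waldspurger_C:
  assumes g: "g \<in> carrier_mat n n"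
  shows "simple_root_mat_C n * waldspurger_C n g = (1\<^sub>m n - g) * weight_mat n"
proof -
  define S where "S = simple_root_mat_C n"
  define R where "R = simple_root_repr_C n g"
  define C where "C = cartan_inv_C n"
  have S: "S \<in> carrier_mat n n" by (simp add: S_def)
  have C: "C \<in> carrier_mat n n" by (simp add: C_def cartan_inv_C_def)
  have R: "R \<in> carrier_mat n n" "S * R = g * S"
    using simple_root_repr_C[OF g] by (simp_all add: R_def S_def)
  have "S * ((1\<^sub>m n - R) * C) = (S * (1\<^sub>m n - R)) * C"
    using S R C by (intro assoc_mult_mat[symmetric]) auto
  also have "S * (1\<^sub>m n - R) = S * 1\<^sub>m n - S * R"
    using S R by (intro mult_minus_distrib_mat) auto
  also have "\<dots> = 1\<^sub>m n * S - g * S" using S R by simp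
  also have "\<dots> = (1\<^sub>m n - g) * S"
    using S g by (intro minus_mult_distrib_mat[symmetric]) auto
  also have "\<dots> * C = (1\<^sub>m n - g) * (S * C)"
    using S g C by (intro assoc_mult_mat) auto
  also have "S * C = weight_mat n" unfolding S_def C_def by (rule cartan_inv_C_weights)
  finally show ?thesis by (simp add: waldspurger_C_def S_def R_def C_def)
qed

lemma mult_weight_mat_index:
  assumes X: "X \<in> carrier_mat n n" and "i < n" and "j < n"
  shows "(X * weight_mat n) $$ (i, j) = (\<Sum>k\<le>j. X $$ (i, k))"
proof -
  have "(X * weight_mat n) $$ (i, j) = (\<Sum>k\<in>{0..<n}. X $$ (i, k) * (if k \<le> j then 1 else 0))"
    using assms by (simp add: scalar_prod_def)
  also have "\<dots> = (\<Sum>k\<in>{0..<n}. if k \<in> {..j} then X $$ (i, k) else 0)"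
    by (intro sum.cong) auto
  also have "\<dots> = (\<Sum>k\<in>{0..<n} \<inter> {..j}. X $$ (i, k))"
    by (rule sum.inter_restrict[symmetric]) simp
  also have "{0..<n} \<inter> {..j} = {..j}" using assms by auto
  finally show ?thesis .
qed

lemma simple_root_mat_C_left_cancel:
  assumes "M \<in> carrier_mat n n" "M' \<in> carrier_mat n n"
    and eq: "simple_root_mat_C n * M = simple_root_mat_C n * M'"
  shows "M = M'"
proof -
  obtain T where T: "T \<in> carrier_mat n n" "T * simple_root_mat_C n = 1\<^sub>m n"
    by (rule simple_root_mat_C_inverse)
  have "T * (simple_root_mat_C n * X) = X" if X: "X \<in> carrier_mat n n" for X
    using assoc_mult_mat[OF T(1) simple_root_mat_C_carrier X] T(2) X by simp
  then show ?thesis using assms by metis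
qed

text \<open>Row \<open>i\<close> of \<open>S * M\<close> is the difference of rows \<open>i\<close> and \<open>i - 1\<close> of \<open>M\<close>, where the long
  root doubles row \<open>n - 1\<close>. Differencing corner sums of \<open>1 - g\<close> returns the partial row sums
  \<open>(1 - g) * \<Omega>\<close>, which determine \<open>M\<close>.\<close>

lemma waldspurger_C_eqI:
  assumes g: "g \<in> carrier_mat n n" and M: "M \<in> carrier_mat n n"
    and corner: "\<And>i j. i < n \<Longrightarrow> j < n \<Longrightarrow>
      (if i = n - 1 then 2 else 1) * M $$ (i, j) = corner_sum (1\<^sub>m n - g) i j"
  shows "M = waldspurger_C n g"
proof (rule simple_root_mat_C_left_cancel[OF M waldspurger_C_carrier[OF g]])
  have X: "1\<^sub>m n - g \<in> carrier_mat n n" using g by auto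
  show "simple_root_mat_C n * M = simple_root_mat_C n * waldspurger_C n g"
    unfolding simple_root_mat_C_mult_waldspurger_C[OF g]
  proof (rule eq_matI)
    fix i j
    assume "i < dim_row ((1\<^sub>m n - g) * weight_mat n)" "j < dim_col ((1\<^sub>m n - g) * weight_mat n)"
    then have ij: "i < n" "j < n" using X by auto
    have "(simple_root_mat_C n * M) $$ (i, j) = (\<Sum>k\<le>j. (1\<^sub>m n - g) $$ (i, k))"
    proof (cases i)
      case 0
      then show ?thesis
        unfolding simple_root_mat_C_mult_index[OF M ij] corner[OF ij] by (simp add: corner_sum_def)
    next
      case (Suc m)
      then have "M $$ (m, j) = corner_sum (1\<^sub>m n - g) m j" using corner[of m j] ij by (simp split: if_splits)
      then show ?thesis
        using Suc unfolding simple_root_mat_C_mult_index[OF M ij] corner[OF ij]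
        by (simp add: corner_sum_def)
    qed
    then show "(simple_root_mat_C n * M) $$ (i, j) = ((1\<^sub>m n - g) * weight_mat n) $$ (i, j)"
      using mult_weight_mat_index[OF X ij] by simp
  qed (use X M carrier_matD[OF simple_root_mat_C_carrier[of n]] in auto)
qed

lemma inj_on_waldspurger_C: "inj_on (waldspurger_C n) (carrier_mat n n)"
proof (rule inj_onI)
  fix g h :: "real mat"
  assume g: "g \<in> carrier_mat n n" and h: "h \<in> carrier_mat n n"
    and eq: "waldspurger_C n g = waldspurger_C n h"
  have X: "1\<^sub>m n - g \<in> carrier_mat n n" "1\<^sub>m n - h \<in> carrier_mat n n" using g h by auto
  have "(1\<^sub>m n - g) * weight_mat n = (1\<^sub>m n - h) * weight_mat n"
    using simple_root_mat_C_mult_waldspurger_C[OF g] simple_root_mat_C_mult_waldspurger_C[OF h] eq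
    by simp
  then have partial: "(\<Sum>k\<le>j. (1\<^sub>m n - g) $$ (i, k)) = (\<Sum>k\<le>j. (1\<^sub>m n - h) $$ (i, k))"
    if "i < n" "j < n" for i j
    using mult_weight_mat_index[OF X(1) that] mult_weight_mat_index[OF X(2) that] by simp
  show "g = h"
  proof (rule eq_matI)
    fix i j assume "i < dim_row h" "j < dim_col h"
    then have ij: "i < n" "j < n" using h by auto
    have "(1\<^sub>m n - g) $$ (i, j) = (1\<^sub>m n - h) $$ (i, j)"
    proof (cases j)
      case 0
      then show ?thesis using partial[OF ij] by simp
    next
      case (Suc m)
      then show ?thesis using partial[OF ij] partial[of i m] ij by (simp del: index_minus_mat)
    qed
    then show "g $$ (i, j) = h $$ (i, j)" using ij g h by simp
  qed (use g h in auto)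
qed

section \<open>The commuting square\<close>

text \<open>The columns of \<open>X\<close> are assumed to sum to zero, so that the corner sum ending in row
  \<open>2 * n - 2 - i\<close> can be computed from the remaining \<open>i + 1\<close> rows, which are the mirror images of
  the first \<open>i + 1\<close> rows.\<close>

lemma corner_sum_add_mirror:
  assumes X: "X \<in> carrier_mat (2 * n) (2 * n)"
    and col: "\<And>j. j < n \<Longrightarrow> (\<Sum>a<2 * n. X $$ (a, j)) = 0"
    and i: "i < n" and j: "j < n"
  shows "corner_sum X i j + corner_sum X (2 * n - 2 - i) j = corner_sum (star n X) i j"
proof -
  let ?m = "2 * n - 2 - i"
  have "(\<Sum>a\<le>i. X $$ (a, b)) + (\<Sum>a\<le>?m. X $$ (a, b)) = (\<Sum>a\<le>i. star n X $$ (a, b))"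
    if b: "b \<le> j" for b
  proof -
    have "(\<Sum>a\<in>{?m<..<2 * n}. X $$ (a, b)) = (\<Sum>a\<le>i. X $$ (2 * n - 1 - a, b))"
      by (rule sum.reindex_bij_witness[of _ "\<lambda>a. 2 * n - 1 - a" "\<lambda>a. 2 * n - 1 - a"])
        (use i in auto)
    then have "(\<Sum>a\<le>?m. X $$ (a, b)) = - (\<Sum>a\<le>i. X $$ (2 * n - 1 - a, b))"
      using col[of b] sum_lessThan_split[of ?m "2 * n" "\<lambda>a. X $$ (a, b)"] i j b by simp
    then have "(\<Sum>a\<le>i. X $$ (a, b)) + (\<Sum>a\<le>?m. X $$ (a, b))
        = (\<Sum>a\<le>i. X $$ (a, b) - X $$ (2 * n - 1 - a, b))"
      by (simp add: sum_subtractf)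
    also have "\<dots> = (\<Sum>a\<le>i. star n X $$ (a, b))"
      using i j b by (intro sum.cong refl) (auto simp: star_def)
    finally show ?thesis .
  qed
  then have "(\<Sum>b\<le>j. (\<Sum>a\<le>i. X $$ (a, b)) + (\<Sum>a\<le>?m. X $$ (a, b)))
      = (\<Sum>b\<le>j. \<Sum>a\<le>i. star n X $$ (a, b))"
    by simp
  then show ?thesis
    unfolding corner_sum_def by (simp add: sum.distrib sum.swap[of _ "{..j}"])
qed

lemma star_one_minus:
  assumes "P \<in> carrier_mat (2 * n) (2 * n)"
  shows "star n (1\<^sub>m (2 * n) - P) = 1\<^sub>m n - star n P"
  using assms by (intro eq_matI) (auto simp: star_def)

text \<open>The mirror argument applies to \<open>X = 1 - P\<close>, whose columns sum to zero because those of a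
  permutation matrix sum to 1 like those of the identity.\<close>

lemma folding_map_waldspurger_A:
  assumes P: "P \<in> permutation_matrices (2 * n)"
  shows "folding_map n (waldspurger_A P) = waldspurger_C n (star n P)"
proof (rule waldspurger_C_eqI)
  show "star n P \<in> carrier_mat n n" by (simp add: star_def)
  show "folding_map n (waldspurger_A P) \<in> carrier_mat n n" by (simp add: folding_map_def)
next
  fix i j assume i: "i < n" and j: "j < n"
  let ?X = "1\<^sub>m (2 * n) - P"
  let ?W = "waldspurger_A P"
  have C: "P \<in> carrier_mat (2 * n) (2 * n)" by (rule permutation_matricesD(1)[OF P])
  have X: "?X \<in> carrier_mat (2 * n) (2 * n)" using C by auto
  have col: "(\<Sum>a<2 * n. ?X $$ (a, b)) = 0" if "b < n" for b
  proof -
    have "(\<Sum>a<2 * n. ?X $$ (a, b)) = (\<Sum>a<2 * n. (if a = b then 1 else 0) - P $$ (a, b))"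
      using that C by (intro sum.cong refl) auto
    then show ?thesis
      using that permutation_matrix_col_sum[OF P, of b] by (simp add: sum_subtractf)
  qed
  \<comment> \<open>The middle row \<open>i = n - 1\<close> is its own partner: \<open>2 * n - 2 - i = i\<close>.\<close>
  have "(if i = n - 1 then 2 else 1) * folding_map n ?W $$ (i, j)
      = ?W $$ (i, j) + ?W $$ (2 * n - 2 - i, j)"
  proof (cases "i = n - 1")
    case True
    then have "2 * n - 2 - i = i" by linarith
    then show ?thesis using True i j by (simp add: folding_map_def)
  qed (use i j in \<open>simp add: folding_map_def\<close>)
  also have "\<dots> = corner_sum ?X i j + corner_sum ?X (2 * n - 2 - i) j"
    using i j by (simp add: waldspurger_A_corner_sum[OF P])
  also have "\<dots> = corner_sum (1\<^sub>m n - star n P) i j"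
    using corner_sum_add_mirror[OF X col i j] by (simp only: star_one_minus[OF C])
  finally show "(if i = n - 1 then 2 else 1) * folding_map n ?W $$ (i, j)
      = corner_sum (1\<^sub>m n - star n P) i j" .
qed

section \<open>Centrally symmetric permutations and signed permutations\<close>

definition near_index :: "nat \<Rightarrow> nat \<Rightarrow> nat" where
  "near_index n i = (if i < n then i else 2 * n - 1 - i)"

lemma near_index_less: "i < 2 * n \<Longrightarrow> near_index n i < n"
  unfolding near_index_def by auto

lemma near_index_mirror: "i < 2 * n \<Longrightarrow> near_index n (2 * n - 1 - i) = near_index n i"
  unfolding near_index_def by auto

text \<open>The entries of the preimage of \<open>g\<close> under \<open>star\<close>: its upper left quadrant is the positive part
  of \<open>g\<close>, its lower left quadrant is the negative part with the rows reversed, and the right half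
  follows by rotation. Taking functions
  rather than matrices makes transposition a mere exchange of arguments.\<close>

definition unstar_entry :: "nat \<Rightarrow> (nat \<Rightarrow> nat \<Rightarrow> real) \<Rightarrow> nat \<Rightarrow> nat \<Rightarrow> real" where
  "unstar_entry n g i j =
     max 0 ((if i < n \<longleftrightarrow> j < n then 1 else -1) * g (near_index n i) (near_index n j))"

definition unstar :: "nat \<Rightarrow> real mat \<Rightarrow> real mat" where
  "unstar n g = mat (2 * n) (2 * n) (\<lambda>(i, j). unstar_entry n (\<lambda>a b. g $$ (a, b)) i j)"

lemma unstar_entry_transpose: "unstar_entry n (\<lambda>a b. g b a) i j = unstar_entry n g j i"
  unfolding unstar_entry_def by auto

lemma signed_permutation_matricesD:
  assumes "g \<in> signed_permutation_matrices n"
  shows "g \<in> carrier_mat n n"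
    and "\<And>i j. i < n \<Longrightarrow> j < n \<Longrightarrow> g $$ (i, j) \<in> {-1, 0, 1}"
    and "\<And>i. i < n \<Longrightarrow> \<exists>!j. j < n \<and> g $$ (i, j) \<noteq> 0"
    and "\<And>j. j < n \<Longrightarrow> \<exists>!i. i < n \<and> g $$ (i, j) \<noteq> 0"
proof -
  note D = assms[unfolded signed_permutation_matrices_def mem_Collect_eq]
  show "g \<in> carrier_mat n n" using D by (rule conjunct1)
  note D = D[THEN conjunct2]
  show "g $$ (i, j) \<in> {-1, 0, 1}" if "i < n" "j < n" for i j
    using D[THEN conjunct1] that by (elim allE impE)
  note D = D[THEN conjunct2]
  show "\<exists>!j. j < n \<and> g $$ (i, j) \<noteq> 0" if "i < n" for i
    using D[THEN conjunct1] that by (elim allE impE)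
  show "\<exists>!i. i < n \<and> g $$ (i, j) \<noteq> 0" if "j < n" for j
    using D[THEN conjunct2] that by (elim allE impE)
qed

lemma unstar_entry_row:
  assumes entries: "\<And>a b. a < n \<Longrightarrow> b < n \<Longrightarrow> g a b \<in> {-1, 0, 1}"
    and row: "\<And>a. a < n \<Longrightarrow> \<exists>!b. b < n \<and> g a b \<noteq> 0"
    and i: "i < 2 * n"
  shows "\<exists>!j. j < 2 * n \<and> unstar_entry n g i j = 1"
proof -
  let ?a = "near_index n i"
  have a: "?a < n" by (rule near_index_less[OF i])
  obtain k where k: "k < n" "g ?a k \<noteq> 0" and uniq: "\<And>b. b < n \<Longrightarrow> g ?a b \<noteq> 0 \<Longrightarrow> b = k"
    using row[OF a] by blast
  \<comment> \<open>A positive entry keeps the unit on the same side as row \<open>i\<close>, a negative one moves it across.\<close>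
  define j where "j = (if i < n \<longleftrightarrow> g ?a k = 1 then k else 2 * n - 1 - k)"
  have near_j: "near_index n j = k" and j_lt: "j < 2 * n"
    and side_j: "j < n \<longleftrightarrow> (i < n \<longleftrightarrow> g ?a k = 1)"
    using k(1) unfolding j_def near_index_def by auto
  show ?thesis
  proof (rule ex1I[of _ j])
    show "j < 2 * n \<and> unstar_entry n g i j = 1"
      using j_lt side_j entries[OF a k(1)] k(2) unfolding unstar_entry_def near_j by auto
  next
    fix l assume l: "l < 2 * n \<and> unstar_entry n g i l = 1"
    then have near_l: "near_index n l < n" by (simp add: near_index_less)
    have pos: "(if i < n \<longleftrightarrow> l < n then 1 else -1) * g ?a (near_index n l) = 1"
      using l unfolding unstar_entry_def by (auto simp: max_def split: if_split_asm)
    then have eq_k: "near_index n l = k" using uniq[OF near_l] by fastforce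
    then have "l < n \<longleftrightarrow> (i < n \<longleftrightarrow> g ?a k = 1)"
      using pos entries[OF a k(1)] by (auto split: if_split_asm)
    then have "l < n \<longleftrightarrow> j < n" using side_j by blast
    moreover have "l = (if l < n then near_index n l else 2 * n - 1 - near_index n l)"
      "j = (if j < n then near_index n j else 2 * n - 1 - near_index n j)"
      using l j_lt unfolding near_index_def by auto
    ultimately show "l = j" using eq_k near_j by metis
  qed
qed

lemma unstar_centrally_symmetric:
  assumes g: "g \<in> signed_permutation_matrices n"
  shows "unstar n g \<in> centrally_symmetric_perms n"
proof -
  let ?g = "\<lambda>a b. g $$ (a, b)"
  note D = signed_permutation_matricesD[OF g]
  have index: "unstar n g $$ (i, j) = unstar_entry n ?g i j" if "i < 2 * n" "j < 2 * n" for i j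
    using that by (simp add: unstar_def)
  have zero_one: "unstar_entry n ?g i j \<in> {0, 1}" if "i < 2 * n" "j < 2 * n" for i j
  proof -
    from D(2)[OF near_index_less[OF that(1)] near_index_less[OF that(2)]]
    consider "g $$ (near_index n i, near_index n j) = -1"
      | "g $$ (near_index n i, near_index n j) = 0"
      | "g $$ (near_index n i, near_index n j) = 1"
      by blast
    then show ?thesis by cases (simp_all add: unstar_entry_def)
  qed
  have row: "\<exists>!j. j < 2 * n \<and> unstar_entry n ?g i j = 1" if "i < 2 * n" for i
    using that by (intro unstar_entry_row D)
  have col: "\<exists>!i. i < 2 * n \<and> unstar_entry n ?g i j = 1" if "j < 2 * n" for j
    using that unfolding unstar_entry_transpose[of n ?g, symmetric]
    by (intro unstar_entry_row D)
  have symm: "unstar_entry n ?g i j = unstar_entry n ?g (2 * n - 1 - i) (2 * n - 1 - j)"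
    if "i < 2 * n" "j < 2 * n" for i j
  proof -
    have "2 * n - 1 - i < n \<longleftrightarrow> \<not> i < n" "2 * n - 1 - j < n \<longleftrightarrow> \<not> j < n"
      using that by linarith+
    then show ?thesis
      unfolding unstar_entry_def near_index_mirror[OF that(1)] near_index_mirror[OF that(2)] by simp
  qed
  have rows: "\<exists>!j. j < 2 * n \<and> unstar n g $$ (i, j) = 1" if "i < 2 * n" for i
    using row[OF that] index[OF that] by (metis (no_types, lifting))
  have cols: "\<exists>!i. i < 2 * n \<and> unstar n g $$ (i, j) = 1" if "j < 2 * n" for j
    using col[OF that] index[OF _ that] by (metis (no_types, lifting))
  have "unstar n g \<in> permutation_matrices (2 * n)"
    unfolding permutation_matrices_def mem_Collect_eq
  proof (intro conjI allI impI)
    show "unstar n g \<in> carrier_mat (2 * n) (2 * n)" by (simp add: unstar_def)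
    show "unstar n g $$ (i, j) \<in> {0, 1}" if "i < 2 * n" "j < 2 * n" for i j
      using zero_one[OF that] by (simp only: index[OF that])
  qed (rule rows cols, assumption)+
  moreover have "unstar n g $$ (i, j) = unstar n g $$ (2 * n - 1 - i, 2 * n - 1 - j)"
    if ij: "i < 2 * n" "j < 2 * n" for i j
  proof -
    have "2 * n - 1 - i < 2 * n" "2 * n - 1 - j < 2 * n" using ij by linarith+
    from index[OF this] show ?thesis using symm[OF ij] index[OF ij] by simp
  qed
  ultimately show ?thesis unfolding centrally_symmetric_perms_def by blast
qed

lemma star_unstar:
  assumes g: "g \<in> signed_permutation_matrices n"
  shows "star n (unstar n g) = g"
proof (rule eq_matI)
  fix i j assume "i < dim_row g" "j < dim_col g"
  then have ij: "i < n" "j < n" using signed_permutation_matricesD(1)[OF g] by auto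
  then have "2 * n - 1 - i < 2 * n" "\<not> 2 * n - 1 - i < n" "2 * n - 1 - (2 * n - 1 - i) = i"
    by linarith+
  then have "star n (unstar n g) $$ (i, j) = max 0 (g $$ (i, j)) - max 0 (- g $$ (i, j))"
    using ij by (simp add: star_def unstar_def unstar_entry_def near_index_def)
  then show "star n (unstar n g) $$ (i, j) = g $$ (i, j)" by (simp add: max_def)
qed (use signed_permutation_matricesD(1)[OF g] in \<open>auto simp: star_def\<close>)

text \<open>An entry and its vertical mirror image lie in the same column, so they are not both 1. Hence
  their difference, an entry of \<open>star n P\<close>, determines both: they are its positive and negative parts.
  Central symmetry then determines the right half of \<open>P\<close>.\<close>

lemma unstar_star:
  assumes P: "P \<in> centrally_symmetric_perms n"
  shows "unstar n (star n P) = P"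
proof -
  have perm: "P \<in> permutation_matrices (2 * n)"
    and symm: "\<And>i j. i < 2 * n \<Longrightarrow> j < 2 * n \<Longrightarrow> P $$ (i, j) = P $$ (2 * n - 1 - i, 2 * n - 1 - j)"
    using P unfolding centrally_symmetric_perms_def by blast+
  note D = permutation_matricesD[OF perm]
  have parts: "P $$ (i, j) = max 0 (P $$ (i, j) - P $$ (2 * n - 1 - i, j))"
    if ij: "i < 2 * n" "j < 2 * n" for i j
  proof -
    have i': "2 * n - 1 - i < 2 * n" "2 * n - 1 - i \<noteq> i" using ij by presburger+
    have "P $$ (i, j) = 0 \<or> P $$ (2 * n - 1 - i, j) = 0"
      using D(4)[OF ij(2)] D(2)[OF ij] D(2)[OF i'(1) ij(2)] ij i' by blast
    then show ?thesis using D(2)[OF ij] D(2)[OF i'(1) ij(2)] by auto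
  qed
  have left: "unstar n (star n P) $$ (i, j) = P $$ (i, j)" if i: "i < 2 * n" and j: "j < n" for i j
  proof (cases "i < n")
    case True
    then show ?thesis
      using parts[of i j] i j
      by (simp add: unstar_def unstar_entry_def star_def near_index_def)
  next
    case False
    then have "2 * n - 1 - (2 * n - 1 - i) = i" "2 * n - 1 - i < n" using i by linarith+
    then show ?thesis
      using parts[of i j] i j False
      by (simp add: unstar_def unstar_entry_def star_def near_index_def)
  qed
  have U: "unstar n (star n P) \<in> centrally_symmetric_perms n"
    by (intro unstar_centrally_symmetric star_signed_permutation P)
  show ?thesis
  proof (rule eq_matI)
    fix i j assume "i < dim_row P" "j < dim_col P"
    then have ij: "i < 2 * n" "j < 2 * n" using D(1) by auto
    show "unstar n (star n P) $$ (i, j) = P $$ (i, j)"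
    proof (cases "j < n")
      case False
      have "unstar n (star n P) $$ (i, j) = unstar n (star n P) $$ (2 * n - 1 - i, 2 * n - 1 - j)"
        using U ij unfolding centrally_symmetric_perms_def by blast
      also have "\<dots> = P $$ (2 * n - 1 - i, 2 * n - 1 - j)"
        using False ij by (intro left) auto
      also have "\<dots> = P $$ (i, j)" using symm[OF ij] by simp
      finally show ?thesis .
    qed (use left ij in simp)
  qed (use D(1) in \<open>auto simp: unstar_def\<close>)
qed

lemma bij_betw_star:
  "bij_betw (star n) (centrally_symmetric_perms n) (signed_permutation_matrices n)"
  by (rule bij_betw_byWitness[of _ "unstar n"])
    (auto simp: unstar_star star_unstar star_signed_permutation unstar_centrally_symmetric)

section \<open>Folding as a bijection\<close>

text \<open>The square exhibits \<open>folding_map n \<circ> waldspurger_A\<close> as a composition of two bijections. As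
  \<open>waldspurger_A\<close> maps onto the domain in question, \<open>folding_map n\<close> is a bijection there.\<close>

theorem theorem11:
  fixes n :: nat
  assumes "n \<ge> 2"
  shows "bij_betw (folding_map n) (waldspurger_A ` centrally_symmetric_perms n)
           (waldspurger_C n ` signed_permutation_matrices n)
       \<and> (\<forall>P \<in> centrally_symmetric_perms n.
            folding_map n (waldspurger_A P) = waldspurger_C n (star n P))"
proof -
  let ?CS = "centrally_symmetric_perms n" and ?B = "signed_permutation_matrices n"
  have square: "folding_map n (waldspurger_A P) = waldspurger_C n (star n P)" if "P \<in> ?CS" for P
    using that unfolding centrally_symmetric_perms_def by (intro folding_map_waldspurger_A) blast
  have "bij_betw (waldspurger_C n) ?B (waldspurger_C n ` ?B)"
    using inj_on_subset[OF inj_on_waldspurger_C, of ?B n] signed_permutation_matricesD(1)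
    by (auto intro: inj_on_imp_bij_betw)
  from bij_betw_trans[OF bij_betw_star this]
  have bij: "bij_betw (folding_map n \<circ> waldspurger_A) ?CS (waldspurger_C n ` ?B)"
    by (rule iffD1[OF bij_betw_cong, rotated]) (simp add: square)
  have "bij_betw (folding_map n) (waldspurger_A ` ?CS) (waldspurger_C n ` ?B)"
    using bij unfolding bij_betw_def by (auto simp: image_comp intro: inj_on_imageI)
  then show ?thesis using square by blast
qed

end
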